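(* Let $x,y$ be real numbers with $x+y>0$ and $y+1>0$. If $0<|x|<1$, then $$\biggl[\frac{\Gamma(x+y+1)}{\Gamma(y+1)}\biggr]^{1/x}>\biggl[\frac{(x+y)^{x+1}}{(x+y+1)^{x-1}}\biggr]^{1/2};$$ if $|x|>1$, then the reversed strict inequality $$\biggl[\frac{\Gamma(x+y+1)}{\Gamma(y+1)}\biggr]^{1/x}<\biggl[\frac{(x+y)^{x+1}}{(x+y+1)^{x-1}}\biggr]^{1/2}$$ holds. In particular, $$\Gamma(x+1)>\biggl[\frac{x^{x+1}}{(x+1)^{x-1}}\biggr]^{x/2}\quad\text{for } 0<x<1,$$ and $$\Gamma(x+1)<\biggl[\frac{x^{x+1}}{(x+1)^{x-1}}\biggr]^{x/2}\quad\text{for } x>1.$$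
   Context: $\Gamma$ denotes the Euler gamma function, $\Gamma(x)=\int_0^\infty t^{x-1}e^{-t}\,dt$ for real $x>0$. *)

theory Defs
  imports "HOL-Analysis.Analysis"
begin

end

theory Submission
  imports Defs
begin

text \<open>
  Put \<open>u = x + y\<close> and fix \<open>u > 0\<close>. After taking logarithms, the difference of the two sides is
  \<open>F(x) / x\<close>, where \<open>F(t) = ln \<Gamma>(u + 1) - ln \<Gamma>(u + 1 - t) - q(t)\<close> and \<open>q\<close> is the
  quadratic polynomial \<open>t ((t + 1) ln u - (t - 1) ln (u + 1)) / 2\<close>, which makes \<open>F\<close> vanish at
  \<open>-1\<close>, \<open>0\<close> and \<open>1\<close>. The error formula for interpolation at these points then gives
  \<open>F(x) = F'''(z) (x\<^sup>3 - x) / 6\<close> for some \<open>z\<close>, and \<open>F'''(z) = \<psi>''(u + 1 - z) < 0\<close>.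
\<close>

text \<open>Rolle's theorem three times over: four zeros of \<open>f\<close> separate three of
  \<open>f'\<close>, these separate two of \<open>f''\<close>, and these enclose one of
  \<open>f'''\<close>. The half-line \<open>t < b\<close> is where \<open>ln_Gamma (b - t)\<close>
  is smooth, which is the later use.\<close>

lemma third_derivative_zero:
  fixes f f' f'' f''' :: "real \<Rightarrow> real"
  assumes d: "\<And>t. t < b \<Longrightarrow> (f has_real_derivative f' t) (at t)"
    and d': "\<And>t. t < b \<Longrightarrow> (f' has_real_derivative f'' t) (at t)"
    and d'': "\<And>t. t < b \<Longrightarrow> (f'' has_real_derivative f''' t) (at t)"
    and ord: "p < q" "q < r" "r < s" "s < b"
    and zeros: "f p = 0" "f q = 0" "f r = 0" "f s = 0"
  shows "\<exists>z<b. f''' z = 0"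
proof -
  have rolle: "\<exists>z>l. z < m \<and> g' z = 0"
    if lm: "l < m" "m < b" "g l = 0" "g m = 0"
      "\<And>t. t < b \<Longrightarrow> (g has_real_derivative g' t) (at t)" for l m and g g' :: "real \<Rightarrow> real"
  proof -
    obtain z where "l < z" "z < m" "g m - g l = (m - l) * g' z"
      using MVT2[of l m g g'] lm(1,2,5) by (metis le_less_trans)
    then show ?thesis
      using lm by auto
  qed
  obtain z1 where z1: "p < z1" "z1 < q" "f' z1 = 0"
    using rolle[of p q f f'] ord zeros d by fastforce
  obtain z2 where z2: "q < z2" "z2 < r" "f' z2 = 0"
    using rolle[of q r f f'] ord zeros d by fastforce
  obtain z3 where z3: "r < z3" "z3 < s" "f' z3 = 0"
    using rolle[of r s f f'] ord zeros d by fastforce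
  obtain w1 where w1: "z1 < w1" "w1 < z2" "f'' w1 = 0"
    using rolle[of z1 z2 f' f''] ord z1 z2 d' by fastforce
  obtain w2 where w2: "z2 < w2" "w2 < z3" "f'' w2 = 0"
    using rolle[of z2 z3 f' f''] ord z2 z3 d' by fastforce
  obtain z where "w1 < z" "z < w2" "f''' z = 0"
    using rolle[of w1 w2 f'' f'''] ord z3 w1 w2 d'' by fastforce
  then show ?thesis
    using ord z3 w2 by (intro exI[of _ z]) auto
qed

text \<open>Since \<open>f\<close> vanishes at the nodes -1, 0, 1, its quadratic interpolant there
  is zero and \<open>f x\<close> is itself the interpolation error.\<close>

lemma interpolation_error_three_points:
  fixes f f' f'' f''' :: "real \<Rightarrow> real"
  assumes d: "\<And>t. t < b \<Longrightarrow> (f has_real_derivative f' t) (at t)"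
    and d': "\<And>t. t < b \<Longrightarrow> (f' has_real_derivative f'' t) (at t)"
    and d'': "\<And>t. t < b \<Longrightarrow> (f'' has_real_derivative f''' t) (at t)"
    and "1 < b" "x < b"
    and zeros: "f (-1) = 0" "f 0 = 0" "f 1 = 0"
    and x: "x \<noteq> -1" "x \<noteq> 0" "x \<noteq> 1"
  shows "\<exists>z<b. f x = f''' z * (x ^ 3 - x) / 6"
proof -
  define w :: "real \<Rightarrow> real" where "w t = t ^ 3 - t" for t
  \<comment> \<open>A combination that vanishes at \<open>x\<close> as well as at the three nodes.
    As the node polynomial \<open>w\<close> has third derivative 6, a zero of \<open>g'''\<close> is
    exactly the error formula.\<close>
  define g where "g t = f t * w x - f x * w t" for t
  define g' where "g' t = f' t * w x - f x * (3 * t ^ 2 - 1)" for t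
  define g'' where "g'' t = f'' t * w x - f x * (6 * t)" for t
  define g''' where "g''' t = f''' t * w x - f x * 6" for t
  have g: "(g has_real_derivative g' t) (at t)" if "t < b" for t
    unfolding g_def g'_def w_def
    by (rule derivative_eq_intros d that refl | simp)+
  have g': "(g' has_real_derivative g'' t) (at t)" if "t < b" for t
    unfolding g'_def g''_def
    by (rule derivative_eq_intros d' that refl | simp)+
  have g'': "(g'' has_real_derivative g''' t) (at t)" if "t < b" for t
    unfolding g''_def g'''_def
    by (rule derivative_eq_intros d'' that refl | simp)+
  have g0: "g (-1) = 0" "g 0 = 0" "g 1 = 0" "g x = 0"
    using zeros by (simp_all add: g_def w_def)
  note tdz = third_derivative_zero[of b g g' g'' g''', OF g g' g'']
  \<comment> \<open>Rolle's theorem needs the four zeros in increasing order, so \<open>x\<close> is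
    placed among the nodes.\<close>
  consider "x < -1" | "-1 < x" "x < 0" | "0 < x" "x < 1" | "1 < x"
    using x by linarith
  then have "\<exists>z<b. g''' z = 0"
  proof cases
    case 1
    then show ?thesis using tdz[of x "-1" 0 1] g0 assms(4,5) by simp
  next
    case 2
    then show ?thesis using tdz[of "-1" x 0 1] g0 assms(4,5) by simp
  next
    case 3
    then show ?thesis using tdz[of "-1" 0 x 1] g0 assms(4,5) by simp
  next
    case 4
    then show ?thesis using tdz[of "-1" 0 1 x] g0 assms(4,5) by simp
  qed
  then show ?thesis
    by (auto simp: g'''_def w_def)
qed

text \<open>Dividing the error formula by \<open>x\<close> cancels the node 0 from
  \<open>x ^ 3 - x\<close>, so the sign is governed by \<open>x ^ 2 - 1\<close> alone, whatever the
  sign of \<open>x\<close>.\<close>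

lemma ln_Gamma_diff_interpolation:
  fixes u x :: real
  assumes "u > 0" "x < u + 1" "x \<noteq> -1" "x \<noteq> 0" "x \<noteq> 1"
  shows "\<exists>c<0. (ln_Gamma (u + 1) - ln_Gamma (u + 1 - x)) / x
           - ((x + 1) * ln u - (x - 1) * ln (u + 1)) / 2 = c * (x ^ 2 - 1)"
proof -
  define L M where "L = ln u" and "M = ln (u + 1)"
  define f where "f t = ln_Gamma (u + 1) - ln_Gamma (u + 1 - t)
      - t * ((t + 1) * L - (t - 1) * M) / 2" for t
  define f' where "f' t = Digamma (u + 1 - t) - (t * (L - M) + (L + M) / 2)" for t
  define f'' where "f'' t = - Polygamma 1 (u + 1 - t) - (L - M)" for t
  \<comment> \<open>The quadratic part is gone, and three sign changes from the inner
    \<open>- t\<close> have turned the minus before \<open>ln_Gamma (u + 1 - t)\<close> into a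
    plus.\<close>
  define f''' where "f''' t = Polygamma 2 (u + 1 - t)" for t
  have pos: "u + 1 - t \<notin> \<int>\<^sub>\<le>\<^sub>0" if "t < u + 1" for t
    using that by (auto elim!: nonpos_Ints_cases)
  have f: "(f has_real_derivative f' t) (at t)" if "t < u + 1" for t
    unfolding f_def f'_def using that
    by (auto intro!: derivative_eq_intros simp: field_simps)
  have f': "(f' has_real_derivative f'' t) (at t)" if "t < u + 1" for t
    unfolding f'_def f''_def using pos[OF that]
    by (auto intro!: derivative_eq_intros simp: field_simps)
  have f'': "(f'' has_real_derivative f''' t) (at t)" if "t < u + 1" for t
    unfolding f''_def f'''_def using pos[OF that]
    by (auto intro!: derivative_eq_intros simp: numeral_2_eq_2)
  have G: "ln_Gamma v = ln (Gamma v)" if "v > 0" for v :: real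
    using that by (simp add: ln_Gamma_real_pos)
  have step: "ln_Gamma (v + 1) = ln_Gamma v + ln v" if "v > 0" for v :: real
    using that Gamma_plus1[OF pos[of "u + 1 - v"]] Gamma_real_pos[of v, THEN less_imp_neq]
    by (auto simp: G ln_mult)
  \<comment> \<open>The functional equation at \<open>u\<close> settles the node 1, and at
    \<open>u + 1\<close> the node -1.\<close>
  have "f (-1) = 0" "f 0 = 0" "f 1 = 0"
    using assms(1) step[of u] step[of "u + 1"] by (simp_all add: f_def L_def M_def add_ac)
  then obtain z where z: "z < u + 1" "f x = f''' z * (x ^ 3 - x) / 6"
    using interpolation_error_three_points[of "u + 1" f f' f'' f''' x, OF f f' f''] assms
    by auto
  have "f''' z < 0"
    unfolding f'''_def using z(1) by (intro Polygamma_real_even_neg) auto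
  moreover have "(ln_Gamma (u + 1) - ln_Gamma (u + 1 - x)) / x
      - ((x + 1) * L - (x - 1) * M) / 2 = f x / x"
    using assms(4) by (simp add: f_def field_simps)
  moreover have "f x / x = f''' z / 6 * (x ^ 2 - 1)"
    using assms(4) z(2) by (simp add: field_simps power2_eq_square power3_eq_cube)
  ultimately show ?thesis
    by (intro exI[of _ "f''' z / 6"]) (simp add: L_def M_def)
qed

text \<open>With \<open>u = x + y\<close> one has \<open>y + 1 = u + 1 - x\<close>, so the previous
  lemma computes \<open>ln A - ln B\<close>; its sign decides both comparisons at once.\<close>

lemma Gamma_ratio_powr_less_iff:
  fixes x y :: real
  assumes "x + y > 0" "y + 1 > 0" "x \<noteq> 0" "\<bar>x\<bar> \<noteq> 1"
  defines "A \<equiv> (Gamma (x + y + 1) / Gamma (y + 1)) powr (1 / x)"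
    and "B \<equiv> ((x + y) powr (x + 1) / (x + y + 1) powr (x - 1)) powr (1 / 2)"
  shows "A < B \<longleftrightarrow> 1 < \<bar>x\<bar>" and "B < A \<longleftrightarrow> \<bar>x\<bar> < 1"
proof -
  have AB: "A > 0" "B > 0"
    using assms(1,2) Gamma_real_pos[of "x + y + 1", THEN less_imp_neq] Gamma_real_pos[of "y + 1", THEN less_imp_neq]
    by (auto simp: A_def B_def)
  have "ln A = (ln_Gamma (x + y + 1) - ln_Gamma (y + 1)) / x"
    using assms(1,2) Gamma_real_pos[of "x + y + 1", THEN less_imp_neq] Gamma_real_pos[of "y + 1", THEN less_imp_neq]
    by (auto simp: A_def ln_powr ln_div ln_Gamma_real_pos)
  moreover have "ln B = ((x + 1) * ln (x + y) - (x - 1) * ln (x + y + 1)) / 2"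
    using assms(1,2) by (simp add: B_def ln_powr ln_div)
  moreover obtain c where "c < 0" "(ln_Gamma (x + y + 1) - ln_Gamma (y + 1)) / x
      - ((x + 1) * ln (x + y) - (x - 1) * ln (x + y + 1)) / 2 = c * (x ^ 2 - 1)"
    using ln_Gamma_diff_interpolation[of "x + y" x] assms(1-4) by fastforce
  ultimately have c: "c < 0" "ln A - ln B = c * (x ^ 2 - 1)"
    by metis+
  \<comment> \<open>\<open>ln\<close> is strictly increasing on the positive reals; the negative
    \<open>c\<close> then reverses the sign of \<open>x ^ 2 - 1\<close>.\<close>
  have "A < B \<longleftrightarrow> c * (x ^ 2 - 1) < 0" "B < A \<longleftrightarrow> 0 < c * (x ^ 2 - 1)"
    unfolding c(2)[symmetric] using AB by simp_all
  moreover have "c * (x ^ 2 - 1) < 0 \<longleftrightarrow> 1 < x ^ 2" "0 < c * (x ^ 2 - 1) \<longleftrightarrow> x ^ 2 < 1"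
    using c(1) by (auto simp: mult_less_0_iff zero_less_mult_iff)
  moreover have "1 < x ^ 2 \<longleftrightarrow> 1 < \<bar>x\<bar>" "x ^ 2 < 1 \<longleftrightarrow> \<bar>x\<bar> < 1"
    using abs_square_le_1[of x] abs_square_less_1[of x] by linarith+
  ultimately show "A < B \<longleftrightarrow> 1 < \<bar>x\<bar>" "B < A \<longleftrightarrow> \<bar>x\<bar> < 1"
    by simp_all
qed

theorem corollary1p1:
  shows "(\<forall>x y :: real. x + y > 0 \<longrightarrow> y + 1 > 0 \<longrightarrow>
            (0 < \<bar>x\<bar> \<and> \<bar>x\<bar> < 1 \<longrightarrow>
               (Gamma (x + y + 1) / Gamma (y + 1)) powr (1 / x)
                 > ((x + y) powr (x + 1) / (x + y + 1) powr (x - 1)) powr (1 / 2)) \<and>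
            (\<bar>x\<bar> > 1 \<longrightarrow>
               (Gamma (x + y + 1) / Gamma (y + 1)) powr (1 / x)
                 < ((x + y) powr (x + 1) / (x + y + 1) powr (x - 1)) powr (1 / 2))) \<and>
         (\<forall>x :: real. 0 < x \<and> x < 1 \<longrightarrow>
            Gamma (x + 1) > (x powr (x + 1) / (x + 1) powr (x - 1)) powr (x / 2)) \<and>
         (\<forall>x :: real. x > 1 \<longrightarrow>
            Gamma (x + 1) < (x powr (x + 1) / (x + 1) powr (x - 1)) powr (x / 2))"
proof (intro conjI allI impI)
  fix x y :: real
  assume "x + y > 0" "y + 1 > 0" "0 < \<bar>x\<bar> \<and> \<bar>x\<bar> < 1"
  then show "(Gamma (x + y + 1) / Gamma (y + 1)) powr (1 / x)
      > ((x + y) powr (x + 1) / (x + y + 1) powr (x - 1)) powr (1 / 2)"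
    by (subst Gamma_ratio_powr_less_iff(2)) auto
next
  fix x y :: real
  assume "x + y > 0" "y + 1 > 0" "\<bar>x\<bar> > 1"
  then show "(Gamma (x + y + 1) / Gamma (y + 1)) powr (1 / x)
      < ((x + y) powr (x + 1) / (x + y + 1) powr (x - 1)) powr (1 / 2)"
    by (subst Gamma_ratio_powr_less_iff(1)) auto
next
  fix x :: real
  assume x: "0 < x \<and> x < 1"
  \<comment> \<open>The case \<open>y = 0\<close>, where the denominator is
    \<open>Gamma 1 = 1\<close>. Raising to the positive power \<open>x\<close> keeps the inequality
    strict and turns the exponents \<open>1 / x\<close> and \<open>1 / 2\<close> into 1 and
    \<open>x / 2\<close>.\<close>
  then have "((x powr (x + 1) / (x + 1) powr (x - 1)) powr (1 / 2)) powr x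
      < (Gamma (x + 1) powr (1 / x)) powr x"
    using Gamma_ratio_powr_less_iff(2)[of x 0] by (intro powr_less_mono2) auto
  then show "Gamma (x + 1) > (x powr (x + 1) / (x + 1) powr (x - 1)) powr (x / 2)"
    using x Gamma_real_pos[of "x + 1"] by (simp add: powr_powr)
next
  fix x :: real
  assume x: "x > 1"
  then have "(Gamma (x + 1) powr (1 / x)) powr x
      < ((x powr (x + 1) / (x + 1) powr (x - 1)) powr (1 / 2)) powr x"
    using Gamma_ratio_powr_less_iff(1)[of x 0] by (intro powr_less_mono2) auto
  then show "Gamma (x + 1) < (x powr (x + 1) / (x + 1) powr (x - 1)) powr (x / 2)"
    using x Gamma_real_pos[of "x + 1"] by (simp add: powr_powr)
qed

end
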